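(* Let $\mathcal H$ be a real Hilbert space, $C\subseteq\mathcal H$ nonempty closed convex, and let $B\colon\mathcal H\to\mathcal H$ be monotone and $L$-Lipschitz ($L>0$) with $S\neq\varnothing$. Let $0\le\beta_k\le\tfrac14$, $\sum_k\beta_k<\infty$, $\theta_k=1-\beta_k$, $x_{-1}=x_0=u_0\in C$, and let $(x_k)$ be generated by $$x_{k+1}=P_C\bigl(x_k-\lambda_kB(u_k)\bigr)\quad(k\ge0),\qquad u_k=x_k+\theta_k(x_k-x_{k-1})+\beta_k(x_k-u_{k-1})\quad(k\ge1),$$ with steps $(\lambda_k)$ produced by the safeguarded ratio rule defined in the context (with or without growth steps), where the initial step $\lambda_0>0$ is arbitrary and the safeguard constant satisfies $0<\kappa\le\tfrac16$. Then $(x_k)$ converges weakly to a point of $S$, with $\|x_{k+1}-x_k\|\to0$ and $\|u_k-x_k\|\to0$; no relation between $\lambda_0$ and $L$ and no further condition is required.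
   Context: $P_C$ is the metric projection onto $C$; monotone means $\langle B(x)-B(y),x-y\rangle\ge0$ for all $x,y\in\mathcal H$; $S=\{z\in C:\langle B(z),x-z\rangle\ge0\ \forall x\in C\}$. Safeguarded ratio rule: fix $\lambda_0>0$, $\kappa>0$, and growth factors $\omega_k\ge0$ with $\sum_k\omega_k<\infty$ (without growth: $\omega_k\equiv0$). With the secant slope $\ell_k=\|B(u_{k+1})-B(u_k)\|/\|u_{k+1}-u_k\|$ (and $\ell_k=0$ if $u_{k+1}=u_k$), set $$\lambda_{k+1}=\min\{\lambda_0,\ \lambda_k(1+\omega_k),\ \kappa/\ell_k\},\qquad k\ge0,$$ where $\kappa/0=+\infty$. The order of computation is: $u_{k+1}$ is formed from $x_{k+1},x_k,u_k$, then $B(u_{k+1})$, $\ell_k$, $\lambda_{k+1}$, and then $x_{k+2}$. *)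

theory Defs
  imports "HOL-Analysis.Analysis"
begin

text \<open>Real Hilbert spaces are types of sort \<open>{real_inner, complete_space}\<close>.\<close>

(* The library's closest_point is restricted to heine_borel (finite-dimensional) spaces. *)
definition metric_proj :: "'a::metric_space set \<Rightarrow> 'a \<Rightarrow> 'a"
  where "metric_proj C x = (THE p. p \<in> C \<and> (\<forall>y\<in>C. dist x p \<le> dist x y))"

definition monotone_operator :: "('a::real_inner \<Rightarrow> 'a) \<Rightarrow> bool"
  where "monotone_operator B \<longleftrightarrow> (\<forall>x y. (B x - B y) \<bullet> (x - y) \<ge> 0)"

definition VI_solutions :: "'a::real_inner set \<Rightarrow> ('a \<Rightarrow> 'a) \<Rightarrow> 'a set"
  where "VI_solutions C B = {z \<in> C. \<forall>x\<in>C. B z \<bullet> (x - z) \<ge> 0}"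

definition weakly_converges_to :: "(nat \<Rightarrow> 'a::real_normed_vector) \<Rightarrow> 'a \<Rightarrow> bool"
  where "weakly_converges_to x p \<longleftrightarrow>
    (\<forall>f::'a \<Rightarrow> real. bounded_linear f \<longrightarrow> (\<lambda>k. f (x k)) \<longlonglongrightarrow> f p)"

definition secant_slope :: "('a::real_normed_vector \<Rightarrow> 'a) \<Rightarrow> 'a \<Rightarrow> 'a \<Rightarrow> real"
  where "secant_slope B v w = (if w = v then 0 else norm (B w - B v) / norm (w - v))"

(* The case distinction encodes the convention kappa / 0 = +infinity
   (in HOL, division by 0 would yield 0). *)
definition ratio_step :: "real \<Rightarrow> real \<Rightarrow> real \<Rightarrow> real \<Rightarrow> real \<Rightarrow> real"
  where "ratio_step lam0 \<kappa> \<omega> lam l =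
    (if l = 0 then min lam0 (lam * (1 + \<omega>))
     else min (min lam0 (lam * (1 + \<omega>))) (\<kappa> / l))"

end

theory Submission
  imports Defs
begin

text \<open>With \<open>w k = u k - x k\<close> the recursion reads \<open>w (k+1) = (x (k+1) - x k) - \<beta> (k+1) w k\<close>, a perturbed
  reflection. For a solution \<open>z\<close> the energy
  \<open>|x (k+1) - z|^2 + |x (k+1) - u k|^2 / 3 + |w k|^2 / 10 + 2 lam (k+1) (B z \<bullet> (x k - z))\<close>
  satisfies, once consecutive steps have ratio close to 1 and \<open>\<beta>\<close> is small,
  \<open>V (k+1) + D k \<le> (1 + M \<beta> (k+1)) V k\<close>, where \<open>D k\<close> controls the increments and \<open>B z \<bullet> (x (k+1) - z)\<close>.
  The steps are bounded below by \<open>min lam0 (\<kappa>/L)\<close> and have summable growth, hence converge to a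
  positive limit, so this regime is always reached. Then \<open>V\<close> converges and \<open>D\<close> is
  summable, so that \<open>|x k - z|\<close> converges for every solution \<open>z\<close>. Weak cluster points are
  solutions by Minty's argument, and Opial's argument gives weak convergence.\<close>

section \<open>Metric projection and the Riesz representation\<close>

text \<open>A minimizing sequence is Cauchy: midpoints of its members stay in \<open>C\<close>, so
  their squared distance to \<open>a\<close> is at least \<open>D\<close>, and the parallelogram
  identity bounds the mutual distances by the excesses over \<open>D\<close>.\<close>

lemma nearest_point_exists:
  fixes C :: "'a::{real_inner, complete_space} set"
  assumes "C \<noteq> {}" "closed C" "convex C"
  obtains p where "p \<in> C" "\<forall>y\<in>C. dist a p \<le> dist a y"
proof -
  define D where "D = (INF y\<in>C. (norm (a - y))\<^sup>2)"
  have bdd: "bdd_below ((\<lambda>y. (norm (a - y))\<^sup>2) ` C)"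
    by (rule bdd_belowI[of _ 0]) auto
  have D_le: "D \<le> (norm (a - y))\<^sup>2" if "y \<in> C" for y
    unfolding D_def by (rule cINF_lower[OF bdd that])
  have "\<exists>y\<in>C. (norm (a - y))\<^sup>2 < D + inverse (real (Suc n))" for n
    using cINF_less_iff[OF assms(1) bdd, of "D + inverse (real (Suc n))"] by (simp add: D_def)
  then obtain s where sC: "\<And>n. s n \<in> C"
    and s: "\<And>n. (norm (a - s n))\<^sup>2 < D + inverse (real (Suc n))" by metis
  have par: "(norm (s m - s n))\<^sup>2 \<le> 2 * inverse (real (Suc m)) + 2 * inverse (real (Suc n))" for m n
  proof -
    have "(1/2) *\<^sub>R s m + (1/2) *\<^sub>R s n \<in> C"
      by (rule convexD[OF assms(3) sC sC]) auto
    then have "D \<le> (norm (a - ((1/2) *\<^sub>R s m + (1/2) *\<^sub>R s n)))\<^sup>2" by (rule D_le)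
    moreover have "(norm (s m - s n))\<^sup>2 = 2 * (norm (a - s m))\<^sup>2 + 2 * (norm (a - s n))\<^sup>2
        - 4 * (norm (a - ((1/2) *\<^sub>R s m + (1/2) *\<^sub>R s n)))\<^sup>2"
      by (simp add: power2_norm_eq_inner inner_simps inner_commute algebra_simps)
    ultimately show ?thesis using s[of m] s[of n] by argo
  qed
  have "Cauchy s"
  proof (rule CauchyI)
    fix e :: real assume "0 < e"
    then have "0 < e\<^sup>2 / 4" by simp
    then obtain N where N: "N \<noteq> 0" "inverse (real N) < e\<^sup>2 / 4"
      using ex_inverse_of_nat_less real_arch_inverse by blast
    have "norm (s m - s n) < e" if "N \<le> m" "N \<le> n" for m n
    proof -
      have inv: "inverse (real (Suc i)) \<le> inverse (real N)" if "N \<le> i" for i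
        using that N(1) by (intro le_imp_inverse_le) auto
      then have "(norm (s m - s n))\<^sup>2 < e\<^sup>2"
        using par[of m n] N(2) inv[OF \<open>N \<le> m\<close>] inv[OF \<open>N \<le> n\<close>] by linarith
      then show ?thesis using \<open>0 < e\<close> by (simp add: power_less_imp_less_base)
    qed
    then show "\<exists>M. \<forall>m\<ge>M. \<forall>n\<ge>M. norm (s m - s n) < e" by blast
  qed
  then obtain p where p: "s \<longlonglongrightarrow> p"
    using Cauchy_convergent unfolding convergent_def by blast
  have "p \<in> C" using assms(2) sC p by (auto simp: closed_sequential_limits)
  moreover have "(norm (a - p))\<^sup>2 \<le> D + 0"
  proof (rule LIMSEQ_le)
    show "(\<lambda>n. (norm (a - s n))\<^sup>2) \<longlonglongrightarrow> (norm (a - p))\<^sup>2" using p by (intro tendsto_intros)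
    show "(\<lambda>n. D + inverse (real (Suc n))) \<longlonglongrightarrow> D + 0"
      by (intro tendsto_intros LIMSEQ_inverse_real_of_nat)
  qed (intro exI allI impI less_imp_le s)
  have "dist a p \<le> dist a y" if "y \<in> C" for y
  proof (rule power2_le_imp_le)
    show "(dist a p)\<^sup>2 \<le> (dist a y)\<^sup>2"
      using \<open>(norm (a - p))\<^sup>2 \<le> D + 0\<close> D_le[OF that] by (simp only: dist_norm)
  qed simp
  ultimately show ?thesis using that by blast
qed

text \<open>Uniqueness of the nearest point makes the definite description in
  \<open>metric_proj\<close> meaningful; the inequality is first-order optimality.\<close>

lemma metric_proj:
  fixes C :: "'a::{real_inner, complete_space} set"
  assumes "C \<noteq> {}" "closed C" "convex C"
  shows metric_proj_in: "metric_proj C a \<in> C"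
    and metric_proj_dot: "y \<in> C \<Longrightarrow> (metric_proj C a - a) \<bullet> (y - metric_proj C a) \<ge> 0"
proof -
  obtain p where p: "p \<in> C" "\<forall>y\<in>C. dist a p \<le> dist a y"
    by (rule nearest_point_exists[OF assms])
  have eq: "metric_proj C a = p"
    unfolding metric_proj_def
    using p any_closest_point_unique[OF assms(3,2)] by (intro the_equality) auto
  show "metric_proj C a \<in> C" using p eq by simp
  show "(metric_proj C a - a) \<bullet> (y - metric_proj C a) \<ge> 0" if "y \<in> C"
    using any_closest_point_dot[OF assms(3,2) p(1) that p(2)] eq
    by (simp add: inner_diff_left)
qed

text \<open>The point \<open>q\<close> of the hyperplane \<open>f = 1\<close> nearest to the origin
  is orthogonal to the kernel of \<open>f\<close>. Since \<open>y - f y *\<^sub>R q\<close> lies in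
  the kernel, a multiple of \<open>q\<close> represents \<open>f\<close>.\<close>

lemma riesz_representation:
  fixes f :: "'a::{real_inner, complete_space} \<Rightarrow> real"
  assumes "bounded_linear f"
  obtains p where "\<And>y. f y = p \<bullet> y"
proof (cases "\<forall>y. f y = 0")
  case True
  then show ?thesis using that[of 0] by simp
next
  case False
  interpret bounded_linear f by fact
  obtain y0 where "f y0 \<noteq> 0" using False by blast
  define H where "H = {y. f y = 1}"
  have "y0 /\<^sub>R f y0 \<in> H" using \<open>f y0 \<noteq> 0\<close> by (simp add: H_def scaleR)
  then have ne: "H \<noteq> {}" by blast
  have cl: "closed H" unfolding H_def
    by (intro closed_Collect_eq continuous_on continuous_intros)
  have cv: "convex H" by (auto simp: H_def convex_def add scaleR)
  define q where "q = metric_proj H 0"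
  have "f q = 1" using metric_proj_in[OF ne cl cv, of 0] by (simp add: H_def q_def)
  have orth: "q \<bullet> v = 0" if "f v = 0" for v
  proof -
    \<comment> \<open>\<open>H\<close> is invariant under translation by \<open>v\<close> and by
      \<open>- v\<close>, so the projection inequality holds with both signs.\<close>
    have "q + v \<in> H" "q - v \<in> H" using \<open>f q = 1\<close> that by (auto simp: H_def add diff)
    then show ?thesis
      using metric_proj_dot[OF ne cl cv, of "q + v" 0] metric_proj_dot[OF ne cl cv, of "q - v" 0]
      by (simp add: q_def[symmetric])
  qed
  have "q \<noteq> 0" using \<open>f q = 1\<close> zero by auto
  show ?thesis
  proof (rule that)
    fix y
    have "q \<bullet> (y - f y *\<^sub>R q) = 0"
      using \<open>f q = 1\<close> by (intro orth) (simp add: diff scaleR)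
    then show "f y = (q /\<^sub>R (q \<bullet> q)) \<bullet> y"
      using \<open>q \<noteq> 0\<close> by (simp add: inner_diff_right field_simps)
  qed
qed

section \<open>Weak cluster points and weak convergence\<close>

text \<open>Weak compactness of balls: view \<open>x k\<close> as the function \<open>y \<mapsto> x k \<bullet> y\<close> in a product of compact
  intervals (Tychonoff). Filters replace the subsequences of the usual formulation.\<close>

lemma bounded_weak_cluster_point:
  fixes x :: "'b \<Rightarrow> 'a::{real_inner, complete_space}"
  assumes "F \<noteq> bot" and "\<And>k. norm (x k) \<le> M"
  obtains G p where "G \<le> F" "G \<noteq> bot" "\<And>y. ((\<lambda>k. x k \<bullet> y) \<longlongrightarrow> p \<bullet> y) G"
proof -
  define g where "g k = (\<lambda>y. x k \<bullet> y)" for k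
  define U where "U = (\<Pi>\<^sub>E y\<in>(UNIV::'a set). {- (M * norm y)..M * norm y})"
  have "compact U"
    using compactin_PiE[of "\<lambda>_::'a. euclidean::real topology" UNIV "\<lambda>y. {- (M * norm y)..M * norm y}"]
    by (simp add: U_def euclidean_product_topology)
  moreover have "g k \<in> U" for k
  proof -
    have "\<bar>x k \<bullet> y\<bar> \<le> M * norm y" for y
      using Cauchy_Schwarz_ineq2[of "x k" y] mult_right_mono[OF assms(2)[of k] norm_ge_zero[of y]] by linarith
    then show ?thesis by (auto simp: U_def g_def abs_le_iff minus_le_iff)
  qed
  moreover have "filtermap g F \<noteq> bot" using assms(1) by (simp add: filtermap_bot_iff)
  ultimately obtain f where f: "f \<in> U" "inf (nhds f) (filtermap g F) \<noteq> bot"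
    unfolding compact_filter by (metis (no_types, lifting) always_eventually eventually_filtermap)
  \<comment> \<open>\<open>G\<close> plays the role of a subsequence: it refines \<open>F\<close>,
    and along it \<open>g\<close> tends to the cluster point \<open>f\<close>. It is proper because
    every neighbourhood of \<open>f\<close> meets every set of the image filter.\<close>
  define G where "G = inf (filtercomap g (nhds f)) F"
  have "G \<noteq> bot"
  proof
    assume "G = bot"
    then have "eventually (\<lambda>_. False) G" by simp
    then obtain P Q where P: "eventually P (nhds f)" and Q: "eventually Q F"
      and PQ: "\<And>k. P (g k) \<Longrightarrow> Q k \<Longrightarrow> False"
      unfolding G_def eventually_inf eventually_filtercomap by blast
    have "eventually (\<lambda>h. \<not> P h) (filtermap g F)"
      unfolding eventually_filtermap using Q by eventually_elim (use PQ in blast)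
    with P have "eventually (\<lambda>_. False) (inf (nhds f) (filtermap g F))"
      unfolding eventually_inf by blast
    with f(2) show False by (simp add: trivial_limit_def)
  qed
  have lim: "((\<lambda>k. x k \<bullet> y) \<longlongrightarrow> f y) G" for y
  proof -
    have "filterlim g (nhds f) G"
      unfolding G_def by (rule filterlim_mono[OF filterlim_filtercomap order_refl]) simp
    then have "((\<lambda>k. g k y) \<longlongrightarrow> f y) G"
      by (rule continuous_on_tendsto_compose[OF continuous_on_product_coordinates[of y]]) simp_all
    then show ?thesis by (simp add: g_def)
  qed
  \<comment> \<open>Linearity survives pointwise limits and membership in \<open>U\<close> gives the
    bound \<open>M\<close>, so Riesz turns \<open>f\<close> into a vector.\<close>
  have "bounded_linear f"
  proof (rule bounded_linear_intro)
    fix a b :: 'a and r :: real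
    show "f (a + b) = f a + f b"
      using tendsto_unique[OF \<open>G \<noteq> bot\<close> lim[of "a + b"]] tendsto_add[OF lim[of a] lim[of b]]
      by (simp add: inner_add_right)
    show "f (r *\<^sub>R a) = r *\<^sub>R f a"
      using tendsto_unique[OF \<open>G \<noteq> bot\<close> lim[of "r *\<^sub>R a"]] tendsto_mult_left[OF lim[of a], of r]
      by simp
    have "f a \<in> {- (M * norm a)..M * norm a}" using f(1) by (auto simp: U_def)
    then show "norm (f a) \<le> norm a * M" by (auto simp: mult.commute abs_le_iff)
  qed
  then obtain p where p: "\<And>y. f y = p \<bullet> y" using riesz_representation by blast
  show ?thesis
    by (rule that[of G p]) (use \<open>G \<noteq> bot\<close> lim p in \<open>auto simp: G_def\<close>)
qed

text \<open>The half-space inequality at the projection \<open>q\<close> of \<open>p\<close> holds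
  at every \<open>x k\<close> and is weakly closed, hence holds at \<open>p\<close> itself and
  forces \<open>q = p\<close>.\<close>

lemma weak_limit_in_closed_convex:
  fixes C :: "'a::{real_inner, complete_space} set"
  assumes "closed C" "convex C" and "\<And>k. x k \<in> C" and "G \<noteq> bot"
    and lim: "\<And>y. ((\<lambda>k. x k \<bullet> y) \<longlongrightarrow> p \<bullet> y) G"
  shows "p \<in> C"
proof -
  have ne: "C \<noteq> {}" using assms(3) by blast
  define q where "q = metric_proj C p"
  have "0 \<le> p \<bullet> (q - p) - q \<bullet> (q - p)"
  proof (rule tendsto_lowerbound[OF _ _ assms(4)])
    show "((\<lambda>k. x k \<bullet> (q - p) - q \<bullet> (q - p)) \<longlongrightarrow> p \<bullet> (q - p) - q \<bullet> (q - p)) G"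
      by (intro tendsto_intros lim)
    have "0 \<le> x k \<bullet> (q - p) - q \<bullet> (q - p)" for k
      using metric_proj_dot[OF ne assms(1,2,3), of p k]
      by (simp add: q_def[symmetric] inner_diff_right inner_diff_left inner_commute)
    then show "\<forall>\<^sub>F k in G. 0 \<le> x k \<bullet> (q - p) - q \<bullet> (q - p)" by simp
  qed
  then have "(q - p) \<bullet> (q - p) \<le> 0" by (simp add: inner_diff_left)
  then have "q = p" using inner_ge_zero[of "q - p"] by (simp add: antisym)
  then show ?thesis using metric_proj_in[OF ne assms(1,2), of p] by (simp add: q_def)
qed

text \<open>Convergence of the distances to points of \<open>S\<close> leaves room for only one weak
  cluster point. As the sequence is bounded, every refinement has a cluster point, so the whole
  sequence converges weakly.\<close>

lemma Opial:
  fixes x :: "nat \<Rightarrow> 'a::{real_inner, complete_space}"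
  assumes "S \<noteq> {}"
    and conv: "\<And>z. z \<in> S \<Longrightarrow> convergent (\<lambda>k. norm (x k - z))"
    and cluster: "\<And>G p. G \<le> sequentially \<Longrightarrow> G \<noteq> bot \<Longrightarrow> (\<And>y. ((\<lambda>k. x k \<bullet> y) \<longlongrightarrow> p \<bullet> y) G) \<Longrightarrow> p \<in> S"
  shows "\<exists>p\<in>S. weakly_converges_to x p"
proof -
  obtain z where "z \<in> S" using assms(1) by blast
  have "Bseq (\<lambda>k. norm (x k - z))" using conv[OF \<open>z \<in> S\<close>] by (rule convergent_imp_Bseq)
  then obtain K where K: "\<And>k. norm (x k - z) \<le> K" unfolding Bseq_def by auto
  have bd: "norm (x k) \<le> K + norm z" for k
    using K[of k] norm_triangle_ineq[of "x k - z" z] by simp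
  obtain G p where G: "G \<le> sequentially" "G \<noteq> bot" "\<And>y. ((\<lambda>k. x k \<bullet> y) \<longlongrightarrow> p \<bullet> y) G"
    using bounded_weak_cluster_point[where F = sequentially and x = x and M = "K + norm z"] bd by auto
  have "p \<in> S" by (rule cluster[OF G])
  have unique: "q = p" if H: "H \<le> sequentially" "H \<noteq> bot" "\<And>y. ((\<lambda>k. x k \<bullet> y) \<longlongrightarrow> q \<bullet> y) H" for H q
  proof -
    have "q \<in> S" by (rule cluster[OF H])
    obtain a b where ab: "(\<lambda>k. norm (x k - p)) \<longlonglongrightarrow> a" "(\<lambda>k. norm (x k - q)) \<longlonglongrightarrow> b"
      using conv \<open>p \<in> S\<close> \<open>q \<in> S\<close> by (meson convergent_def)
    \<comment> \<open>The difference of the two squared distances is affine in \<open>x k\<close>,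
      so \<open>x k \<bullet> (q - p)\<close> converges along the full sequence and its limits along
      \<open>G\<close> and \<open>H\<close> agree.\<close>
    have "(\<lambda>k. ((norm (x k - p))\<^sup>2 - (norm (x k - q))\<^sup>2 + q \<bullet> q - p \<bullet> p) / 2)
        \<longlonglongrightarrow> (a\<^sup>2 - b\<^sup>2 + q \<bullet> q - p \<bullet> p) / 2"
      by (intro tendsto_intros ab) simp
    moreover have "((norm (x k - p))\<^sup>2 - (norm (x k - q))\<^sup>2 + q \<bullet> q - p \<bullet> p) / 2 = x k \<bullet> (q - p)" for k
      by (simp add: power2_norm_eq_inner inner_diff_left inner_diff_right inner_commute field_simps)
    ultimately have *: "(\<lambda>k. x k \<bullet> (q - p)) \<longlonglongrightarrow> (a\<^sup>2 - b\<^sup>2 + q \<bullet> q - p \<bullet> p) / 2" by simp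
    have "p \<bullet> (q - p) = q \<bullet> (q - p)"
      using tendsto_unique[OF G(2) G(3) tendsto_mono[OF G(1) *]]
        tendsto_unique[OF H(2) H(3) tendsto_mono[OF H(1) *]] by simp
    then have "(q - p) \<bullet> (q - p) = 0" by (simp add: inner_diff_left)
    then show ?thesis by simp
  qed
  have "(\<lambda>k. x k \<bullet> y) \<longlonglongrightarrow> p \<bullet> y" for y
  proof (rule ccontr)
    assume "\<not> ?thesis"
    then obtain e where "e > 0" and ev: "\<not> eventually (\<lambda>k. dist (x k \<bullet> y) (p \<bullet> y) < e) sequentially"
      unfolding tendsto_iff by blast
    \<comment> \<open>\<open>F\<close> keeps only the indices at which
      \<open>x k \<bullet> y\<close> is at least \<open>e\<close> away from
      \<open>p \<bullet> y\<close>; by uniqueness a cluster point along it would still be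
      \<open>p\<close>.\<close>
    define F where "F = inf sequentially (principal {k. \<not> dist (x k \<bullet> y) (p \<bullet> y) < e})"
    have "F \<noteq> bot"
      using ev by (simp add: F_def trivial_limit_def eventually_inf_principal)
    then obtain H q where H: "H \<le> F" "H \<noteq> bot" "\<And>y. ((\<lambda>k. x k \<bullet> y) \<longlongrightarrow> q \<bullet> y) H"
      using bounded_weak_cluster_point[where F = F and x = x and M = "K + norm z"] bd by auto
    have "q = p" by (rule unique[OF order_trans[OF H(1)] H(2,3)]) (simp add: F_def)
    have "eventually (\<lambda>k. dist (x k \<bullet> y) (p \<bullet> y) < e) H"
      using tendstoD[OF H(3) \<open>e > 0\<close>] \<open>q = p\<close> by simp
    moreover have "eventually (\<lambda>k. \<not> dist (x k \<bullet> y) (p \<bullet> y) < e) H"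
      by (rule filter_leD[OF H(1)]) (simp add: F_def eventually_inf_principal)
    ultimately have "eventually (\<lambda>_. False) H" by eventually_elim simp
    with H(2) show False by (simp add: trivial_limit_def)
  qed
  note lim = this
  have "weakly_converges_to x p"
    unfolding weakly_converges_to_def
  proof (intro allI impI)
    fix f :: "'a \<Rightarrow> real" assume "bounded_linear f"
    then obtain r where "\<And>y. f y = r \<bullet> y" using riesz_representation by blast
    then show "(\<lambda>k. f (x k)) \<longlonglongrightarrow> f p" using lim[of r] by (simp add: inner_commute)
  qed
  with \<open>p \<in> S\<close> show ?thesis by blast
qed

section \<open>One-step descent of the energy\<close>

text \<open>In the application \<open>x0, x1, x2\<close> are three consecutive iterates, \<open>u0, u1\<close> the reflected points
  of the first two, and \<open>l0, l1, l2\<close> the steps. The \<open>\<beta>\<close>-errors of the reflection enter only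
  through \<open>(B u0 - B z) \<bullet> (u0 - x0)\<close>, because the terms in \<open>B z\<close> alone cancel; this makes them
  relative errors of the energy although \<open>B\<close> is unbounded.\<close>

lemma projected_reflected_gradient_descent:
  fixes B :: "'a::real_inner \<Rightarrow> 'a"
  assumes "monotone_operator B" and lip: "L-lipschitz_on UNIV B"
    and ux: "u1 - x1 = (x1 - x0) - \<beta> *\<^sub>R (u0 - x0)"
    and proj2: "0 \<le> (x2 - x1 + l1 *\<^sub>R B u1) \<bullet> (z - x2)"
    and proj1: "0 \<le> (x1 - x0 + l0 *\<^sub>R B u0) \<bullet> (x2 - x1)" "0 \<le> (x1 - x0 + l0 *\<^sub>R B u0) \<bullet> (x0 - x1)"
    and secant: "l1 * norm (B u1 - B u0) \<le> \<kappa> * norm (u1 - u0)" and "0 \<le> \<kappa>" "\<kappa> \<le> 1/6"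
    and \<beta>: "0 \<le> \<beta>" "\<beta> \<le> 1/100"
    and "0 < l0" "9/10 * l0 \<le> l1" "l1 \<le> 11/10 * l0" "l1 \<le> \<Lambda>"
    and "0 \<le> c" "c \<le> l1" "l2 \<le> 11/10 * l1"
    and a: "0 \<le> B z \<bullet> (x0 - z)" "0 \<le> B z \<bullet> (x1 - z)"
  shows "(norm (x2 - z))\<^sup>2 + (norm (x2 - u1))\<^sup>2 / 3 + (norm (u1 - x1))\<^sup>2 / 10 + 2 * l2 * (B z \<bullet> (x1 - z))
       + ((norm (u1 - x1))\<^sup>2 / 10 + (norm (x2 - u1))\<^sup>2 / 10 + c * (B z \<bullet> (x1 - z)))
    \<le> (1 + (22 + 10 * \<Lambda> * L) * \<beta>) *
      ((norm (x1 - z))\<^sup>2 + (norm (x1 - u0))\<^sup>2 / 3 + (norm (u0 - x0))\<^sup>2 / 10 + 2 * l1 * (B z \<bullet> (x0 - z)))"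
proof -
  define P where "P = (norm (x1 - z))\<^sup>2"
  define P2 where "P2 = (norm (x2 - z))\<^sup>2"
  define d where "d = (norm (u1 - x1))\<^sup>2"
  define d0 where "d0 = (norm (u0 - x0))\<^sup>2"
  define e where "e = (norm (x1 - u0))\<^sup>2"
  define e2 where "e2 = (norm (x2 - u1))\<^sup>2"
  define D where "D = (norm (x2 - x1))\<^sup>2"
  define A0 where "A0 = B z \<bullet> (x0 - z)"
  define A1 where "A1 = B z \<bullet> (x1 - z)"
  define w0 where "w0 = u0 - x0"
  define \<rho> where "\<rho> = l1 / l0"
  note defs = P_def P2_def d_def d0_def e_def e2_def D_def power2_norm_eq_inner
  have nn: "0 \<le> P" "0 \<le> d" "0 \<le> d0" "0 \<le> e" "0 \<le> e2" "0 \<le> D" "0 \<le> A0" "0 \<le> A1"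
    using a by (auto simp: P_def d_def d0_def e_def e2_def D_def A0_def A1_def)
  have l1: "0 < l1" using assms by linarith
  have L: "0 \<le> L" using lip by (rule lipschitz_on_nonneg)
  have \<rho>: "9/10 \<le> \<rho>" "\<rho> \<le> 11/10" "\<rho> * l0 = l1" using assms by (auto simp: \<rho>_def field_simps)
  have u1: "u1 = 2 *\<^sub>R x1 - x0 - \<beta> *\<^sub>R w0" using ux by (simp add: w0_def algebra_simps scaleR_2)
  have two: "2 * (p \<bullet> q) \<le> p \<bullet> p + q \<bullet> q" for p q :: 'a
    using inner_ge_zero[of "p - q"] by (simp add: inner_diff_left inner_diff_right inner_commute)

  have step1: "P2 + D \<le> P - 2 * (l1 * (B u1 \<bullet> (x2 - z)))"
    using proj2 by (simp add: defs inner_simps inner_commute algebra_simps)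

  \<comment> \<open>Adding the projection inequalities at \<open>x1\<close> tested with
    \<open>x2\<close> and \<open>x0\<close> controls \<open>B u0\<close> along
    \<open>(x1 - x2) + (x1 - x0)\<close>, which is \<open>u1 - x2\<close> up to a \<beta>-term.
    Multiplying by \<rho> turns \<open>l0\<close> into \<open>l1\<close>.\<close>
  have "l0 * (B u0 \<bullet> ((x1 - x2) + (x1 - x0))) \<le> (x1 - x0) \<bullet> ((x2 - x1) - (x1 - x0))"
    using proj1 by (simp add: inner_simps inner_commute algebra_simps)
  then have "\<rho> * (l0 * (B u0 \<bullet> ((x1 - x2) + (x1 - x0)))) \<le> \<rho> * ((x1 - x0) \<bullet> ((x2 - x1) - (x1 - x0)))"
    using \<rho> by (intro mult_left_mono) auto
  then have reflected: "2 * (l1 * (B u0 \<bullet> ((x1 - x2) + (x1 - x0)))) \<le> \<rho> * (2 * ((x1 - x0) \<bullet> ((x2 - x1) - (x1 - x0))))"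
    using \<rho>(3) by (simp add: mult.assoc[symmetric])
  \<comment> \<open>For \<beta> = 0 this is polarization, since then
    \<open>x1 - x0 = u1 - x1\<close>.\<close>
  have "2 * ((x1 - x0) \<bullet> ((x2 - x1) - (x1 - x0)))
      = (D - d - e2) + \<beta> * (2 * ((x1 - u1) \<bullet> w0)) + \<beta> * (2 * (w0 \<bullet> (x2 - u1))) - 2 * (\<beta> * \<beta> * d0)"
    unfolding u1 defs by (simp add: w0_def inner_simps inner_commute algebra_simps)
  also have "\<dots> \<le> (D - d - e2) + \<beta> * (d + d0) + \<beta> * (d0 + e2) - 0"
    using two[of "x1 - u1" w0] two[of w0 "x2 - u1"] nn \<beta>(1)
    by (intro add_mono diff_mono mult_left_mono order_refl) (auto simp: d_def d0_def e2_def w0_def dot_square_norm norm_minus_commute)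
  finally have "\<rho> * (2 * ((x1 - x0) \<bullet> ((x2 - x1) - (x1 - x0)))) \<le> \<rho> * (D - d - e2 + \<beta> * (d + 2 * d0 + e2))"
    using \<rho> by (intro mult_left_mono) (auto simp: algebra_simps)
  also have "\<dots> = (\<rho> - 1) * D + D - \<rho> * (d + e2) + (\<rho> * \<beta>) * (d + 2 * d0 + e2)"
    by (simp add: algebra_simps)
  \<comment> \<open>\<open>D\<close> must keep coefficient 1 to cancel against \<open>step1\<close>.
    The excess \<open>(\<rho> - 1) * D\<close> is paid out of \<open>d\<close> and
    \<open>e2\<close>, leaving 9/10 - 2/10 = 7/10.\<close>
  also have "\<dots> \<le> 1/10 * (2 * d + 2 * e2) + D - 9/10 * (d + e2) + (11/10 * \<beta>) * (d + 2 * d0 + e2)"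
  proof (intro add_mono diff_mono mult_right_mono order_refl)
    have "D \<le> 2 * d + 2 * e2"
      using inner_ge_zero[of "(u1 - x1) - (x2 - u1)"]
      by (simp add: defs inner_simps inner_commute algebra_simps)
    then show "(\<rho> - 1) * D \<le> 1/10 * (2 * d + 2 * e2)"
      using \<rho> nn by (intro mult_mono) auto
  qed (use \<rho> nn \<beta>(1) in auto)
  also have "\<dots> = D - 7/10 * (d + e2) + 11/10 * \<beta> * (d + 2 * d0 + e2)"
    by (simp add: field_simps)
  finally have step2: "2 * (l1 * (B u0 \<bullet> ((x1 - x2) + (x1 - x0))))
      \<le> D - 7/10 * (d + e2) + 11/10 * \<beta> * (d + 2 * d0 + e2)"
    using reflected by (rule order_trans[rotated])

  \<comment> \<open>The bound 1/6 on \<kappa> makes the coefficient of \<open>e\<close> exactly 1/3,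
    its weight in the old energy.\<close>
  have "2 * (l1 * ((B u1 - B u0) \<bullet> (u1 - x2))) \<le> 2 * (1/6 * norm (u1 - u0) * norm (x2 - u1))"
  proof -
    have "l1 * ((B u1 - B u0) \<bullet> (u1 - x2)) \<le> l1 * (norm (B u1 - B u0) * norm (u1 - x2))"
      using l1 by (intro mult_left_mono norm_cauchy_schwarz) auto
    also have "\<dots> = l1 * norm (B u1 - B u0) * norm (x2 - u1)" by (simp add: norm_minus_commute)
    also have "\<dots> \<le> 1/6 * norm (u1 - u0) * norm (x2 - u1)"
      using secant mult_right_mono[OF \<open>\<kappa> \<le> 1/6\<close> norm_ge_zero[of "u1 - u0"]]
      by (intro mult_right_mono) auto
    finally show ?thesis by linarith
  qed
  also have "\<dots> \<le> 1/6 * ((norm (u1 - u0))\<^sup>2 + e2)"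
    using sum_squares_bound[of "norm (u1 - u0)" "norm (x2 - u1)"] by (simp add: e2_def)
  also have "(norm (u1 - u0))\<^sup>2 \<le> 2 * d + 2 * e"
    using inner_ge_zero[of "(u1 - x1) - (x1 - u0)"]
    by (simp add: defs inner_simps inner_commute algebra_simps)
  finally have step3: "2 * (l1 * ((B u1 - B u0) \<bullet> (u1 - x2))) \<le> d / 3 + e / 3 + e2 / 6" by simp

  \<comment> \<open>The Lipschitz bound reduces this error to \<open>norm (u0 - z)\<close> and
    \<open>norm w0\<close>, whose squares are controlled by \<open>P\<close>, \<open>e\<close> and
    \<open>d0\<close>, all parts of the old energy.\<close>
  have "- (2 * (l1 * ((B u0 - B z) \<bullet> w0))) \<le> 2 * (\<Lambda> * (L * norm (u0 - z) * norm w0))"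
  proof -
    have "- ((B u0 - B z) \<bullet> w0) \<le> norm (B u0 - B z) * norm w0"
      using Cauchy_Schwarz_ineq2[of "B u0 - B z" w0] by linarith
    also have "\<dots> \<le> L * norm (u0 - z) * norm w0"
      using lipschitz_onD[OF lip, of u0 z] by (intro mult_right_mono) (auto simp: dist_norm)
    finally have "l1 * (- ((B u0 - B z) \<bullet> w0)) \<le> l1 * (L * norm (u0 - z) * norm w0)"
      using l1 by (intro mult_left_mono) auto
    also have "\<dots> \<le> \<Lambda> * (L * norm (u0 - z) * norm w0)"
      using \<open>l1 \<le> \<Lambda>\<close> L by (intro mult_right_mono) auto
    finally show ?thesis by linarith
  qed
  also have "\<dots> = \<Lambda> * L * (2 * norm (u0 - z) * norm w0)" by (simp only: mult_ac)
  also have "\<dots> \<le> \<Lambda> * L * ((norm (u0 - z))\<^sup>2 + (norm w0)\<^sup>2)"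
    using l1 L \<open>l1 \<le> \<Lambda>\<close> by (intro mult_left_mono sum_squares_bound) auto
  also have "\<dots> \<le> \<Lambda> * L * ((2 * P + 2 * e) + d0)"
  proof (intro mult_left_mono add_mono)
    show "(norm (u0 - z))\<^sup>2 \<le> 2 * P + 2 * e"
      using inner_ge_zero[of "(u0 - x1) - (x1 - z)"]
      by (simp add: defs inner_simps inner_commute algebra_simps)
  qed (use l1 L \<open>l1 \<le> \<Lambda>\<close> in \<open>auto simp: d0_def w0_def\<close>)
  finally have "\<beta> * (- (2 * (l1 * ((B u0 - B z) \<bullet> w0)))) \<le> \<beta> * (\<Lambda> * L * ((2 * P + 2 * e) + d0))"
    using \<beta>(1) by (intro mult_left_mono) auto
  then have step4: "- (2 * (l1 * (\<beta> * ((B u0 - B z) \<bullet> w0)))) \<le> (\<Lambda> * L * \<beta>) * (2 * P + 2 * e + d0)"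
    by (simp add: algebra_simps)

  have "0 \<le> (B u1 - B z) \<bullet> (u1 - z)" using assms(1) by (simp add: monotone_operator_def)
  then have "0 \<le> 2 * (l1 * ((B u1 - B z) \<bullet> (u1 - z)))" using l1 by simp
  \<comment> \<open>Split \<open>B u1\<close> as \<open>(B u1 - B u0) + B u0\<close> and expand
    \<open>u1\<close> in the product with \<open>B z\<close>: the extrapolation yields
    \<open>2 * A1 - A0\<close>, and the \<beta>-parts of \<open>B u0\<close> and \<open>B z\<close>
    combine into a difference.\<close>
  moreover have "(B u1 - B z) \<bullet> (u1 - z) - B u1 \<bullet> (x2 - z) = (B u1 - B u0) \<bullet> (u1 - x2)
      + B u0 \<bullet> ((x1 - x2) + (x1 - x0)) - \<beta> * ((B u0 - B z) \<bullet> w0) - (2 * A1 - A0)"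
    unfolding u1 A0_def A1_def by (simp add: inner_simps inner_commute algebra_simps)
  then have "2 * (l1 * ((B u1 - B z) \<bullet> (u1 - z))) - 2 * (l1 * (B u1 \<bullet> (x2 - z)))
     = 2 * (l1 * ((B u1 - B u0) \<bullet> (u1 - x2))) + 2 * (l1 * (B u0 \<bullet> ((x1 - x2) + (x1 - x0))))
      - 2 * (l1 * (\<beta> * ((B u0 - B z) \<bullet> w0))) - 2 * (l1 * (2 * A1 - A0))"
    by (simp only: right_diff_distrib[symmetric] distrib_left[symmetric])
  ultimately have main: "P2 \<le> P + (d / 3 + e / 3 + e2 / 6) - 7/10 * (d + e2)
      + 11/10 * \<beta> * (d + 2 * d0 + e2) + (\<Lambda> * L * \<beta>) * (2 * P + 2 * e + d0) - 2 * (l1 * (2 * A1 - A0))"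
    using step1 step2 step3 step4 by linarith

  define S where "S = P + e / 3 + d0 / 10 + 2 * l1 * A0"
  have "0 \<le> l1 * A0" using nn l1 by simp
  \<comment> \<open>These two bounds produce the constants: 22/10 times 10 gives 22, and the
    Lipschitz error gives \<open>10 * \<Lambda> * L\<close>.\<close>
  then have S: "d0 \<le> 10 * S" "2 * P + 2 * e + d0 \<le> 10 * S" using nn by (simp_all add: S_def)
  have "11/10 * \<beta> * (d + 2 * d0 + e2) = 11/10 * (\<beta> * (d + e2)) + 22/10 * (\<beta> * d0)"
    by (simp add: algebra_simps)
  moreover have "\<beta> * (d + e2) \<le> 1/100 * (d + e2)" using nn \<beta> by (intro mult_right_mono) auto
  moreover have "\<beta> * d0 \<le> \<beta> * (10 * S)" using S \<beta>(1) by (intro mult_left_mono)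
  moreover have "(\<Lambda> * L * \<beta>) * (2 * P + 2 * e + d0) \<le> (\<Lambda> * L * \<beta>) * (10 * S)"
    using S l1 L \<open>l1 \<le> \<Lambda>\<close> \<beta>(1) by (intro mult_left_mono) auto
  moreover have "2 * (l1 * (2 * A1 - A0)) = 4 * (l1 * A1) - 2 * l1 * A0"
    by (simp add: algebra_simps)
  \<comment> \<open>The extrapolation provides \<open>4 * l1 * A1\<close>; the new energy takes at
    most 2.2 and the decrease at most 1 of these four multiples.\<close>
  moreover have "2 * l2 * A1 + c * A1 \<le> 4 * (l1 * A1)"
  proof -
    have "(2 * l2 + c) * A1 \<le> (4 * l1) * A1" using assms nn by (intro mult_right_mono) linarith+
    then show ?thesis by (simp add: algebra_simps)
  qed
  moreover have "(1 + (22 + 10 * \<Lambda> * L) * \<beta>) * S = S + 22 / 10 * (\<beta> * (10 * S)) + (\<Lambda> * L * \<beta>) * (10 * S)"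
    by (simp add: algebra_simps)
  \<comment> \<open>The balance closes with slack: \<open>d\<close> needs 1/3 + 2/10 + 11/1000 and
    \<open>e2\<close> needs 1/6 + 1/3 + 1/10 + 11/1000, both below 7/10.\<close>
  ultimately have "P2 + e2 / 3 + d / 10 + 2 * l2 * A1 + (d / 10 + e2 / 10 + c * A1)
    \<le> (1 + (22 + 10 * \<Lambda> * L) * \<beta>) * S"
    using main S_def nn by argo
  then show ?thesis
    by (simp only: S_def P_def P2_def d_def d0_def e_def e2_def A0_def A1_def)
qed

section \<open>Almost monotone real sequences\<close>

text \<open>Subtracting the partial sums of \<open>s\<close> makes \<open>V\<close> decreasing from
  \<open>N\<close> on and keeps it bounded below; telescoping then bounds the sums of
  \<open>D\<close>.\<close>

lemma convergent_of_almost_decreasing: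
  fixes V D s :: "nat \<Rightarrow> real"
  assumes step: "\<And>k. k \<ge> N \<Longrightarrow> V (Suc k) + D k \<le> V k + s k"
    and D: "\<And>k. 0 \<le> D k" and V: "\<And>k. K \<le> V k" and "summable s"
  shows "convergent V" "summable D"
proof -
  define W where "W k = V k - (\<Sum>i<k. s i)" for k
  have Wstep: "W (Suc k) + D k \<le> W k" if "k \<ge> N" for k
    using step[OF that] by (simp add: W_def)
  have "Bseq (\<lambda>k. \<Sum>i<k. s i)"
    using assms(4) by (intro convergent_imp_Bseq) (simp add: summable_iff_convergent)
  then obtain M where M: "\<And>k. \<bar>\<Sum>i<k. s i\<bar> \<le> M" unfolding Bseq_def by auto
  have Wlow: "K - M \<le> W k" for k using V[of k] M[of k] by (simp add: W_def)
  have "decseq (\<lambda>n. W (n + N))"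
    using Wstep D by (intro decseq_SucI) (smt (verit) add_Suc le_add2)
  then have "convergent (\<lambda>n. W (n + N))"
    using Wlow decseq_convergent[of "\<lambda>n. W (n + N)" "K - M"] unfolding convergent_def by blast
  then have "convergent W" by (simp add: convergent_ignore_initial_segment)
  then have "convergent (\<lambda>k. W k + (\<Sum>i<k. s i))"
    using assms(4) by (intro convergent_add) (simp_all add: summable_iff_convergent)
  then show "convergent V" by (simp add: W_def)
  have "(\<Sum>i<n. D (i + N)) \<le> W N - (K - M)" for n
  proof -
    have "(\<Sum>i<n. D (i + N)) \<le> W N - W (n + N)"
    proof (induction n)
      case (Suc n)
      then show ?case using Wstep[of "n + N"] by simp
    qed simp
    then show ?thesis using Wlow[of "n + N"] by linarith
  qed
  then have "summable (\<lambda>i. D (i + N))"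
    using D by (intro summableI_nonneg_bounded) auto
  then show "summable D" by (simp add: summable_iff_shift)
qed

text \<open>The factors \<open>1 + b k\<close> have product at most the exponential of the sum of
  \<open>b\<close>, so \<open>V\<close> is bounded from \<open>N\<close> on and the relative error
  becomes a summable absolute one.\<close>

lemma robbins_siegmund:
  fixes V D b :: "nat \<Rightarrow> real"
  assumes step: "\<And>k. k \<ge> N \<Longrightarrow> V (Suc k) + D k \<le> (1 + b k) * V k"
    and D: "\<And>k. 0 \<le> D k" and V: "\<And>k. 0 \<le> V k" and b: "\<And>k. 0 \<le> b k" and "summable b"
  shows "convergent V" "summable D"
proof -
  have "V (n + N) \<le> V N * exp (\<Sum>i<n. b (i + N))" for n
  proof (induction n)
    case (Suc n)
    have "V (Suc n + N) \<le> (1 + b (n + N)) * V (n + N)"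
      using step[of "n + N"] D[of "n + N"] by simp
    also have "\<dots> \<le> exp (b (n + N)) * (V N * exp (\<Sum>i<n. b (i + N)))"
      using Suc V by (intro mult_mono exp_ge_add_one_self) auto
    finally show ?case by (simp add: exp_add mult_ac)
  qed simp
  moreover have "exp (\<Sum>i<n. b (i + N)) \<le> exp (\<Sum>i. b (i + N))" for n
    using sum_le_suminf[of "\<lambda>i. b (i + N)" "{..<n}"] b assms(5) by simp
  ultimately have bound: "V (n + N) \<le> V N * exp (\<Sum>i. b (i + N))" for n
    using V[of N] by (meson mult_left_mono order_trans)
  define M where "M = V N * exp (\<Sum>i. b (i + N))"
  have "V (Suc k) + D k \<le> V k + b k * M" if "k \<ge> N" for k
  proof -
    have "b k * V k \<le> b k * M"
      using bound[of "k - N"] that b[of k] by (intro mult_left_mono) (auto simp: M_def)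
    then show ?thesis using step[OF that] by (simp add: algebra_simps)
  qed
  moreover have "summable (\<lambda>k. b k * M)" using assms(5) by (rule summable_mult2)
  ultimately show "convergent V" "summable D"
    using convergent_of_almost_decreasing[of N V D "\<lambda>k. b k * M" 0] D V by blast+
qed

section \<open>Weak and strong forms of the variational inequality\<close>

text \<open>Apply the hypothesis at points of the segment from \<open>p\<close> to \<open>y\<close>,
  divide by the segment parameter and let it tend to 0, using continuity of
  \<open>B\<close>.\<close>

lemma minty:
  fixes C :: "'a::real_inner set"
  assumes "convex C" "continuous_on UNIV B" "p \<in> C" and minty: "\<And>y. y \<in> C \<Longrightarrow> 0 \<le> B y \<bullet> (y - p)"
  shows "p \<in> VI_solutions C B"
  unfolding VI_solutions_def
proof (intro CollectI conjI ballI)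
  fix y assume "y \<in> C"
  define v where "v n = p + inverse (real (Suc n)) *\<^sub>R (y - p)" for n
  have "v \<longlonglongrightarrow> p + 0 *\<^sub>R (y - p)"
    unfolding v_def by (intro tendsto_intros LIMSEQ_inverse_real_of_nat)
  then have "(\<lambda>n. B (v n)) \<longlonglongrightarrow> B p"
    using continuous_on_tendsto_compose[OF assms(2)] by simp
  then have lim: "(\<lambda>n. B (v n) \<bullet> (y - p)) \<longlonglongrightarrow> B p \<bullet> (y - p)" by (intro tendsto_intros)
  have "0 \<le> B (v n) \<bullet> (y - p)" for n
  proof -
    have "(1 - inverse (real (Suc n))) *\<^sub>R p + inverse (real (Suc n)) *\<^sub>R y \<in> C"
      using assms(1) \<open>p \<in> C\<close> \<open>y \<in> C\<close> by (rule convexD_alt) (simp_all add: field_simps)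
    moreover have "(1 - t) *\<^sub>R p + t *\<^sub>R y = p + t *\<^sub>R (y - p)" for t :: real
      by (simp add: algebra_simps)
    ultimately have "v n \<in> C" by (simp add: v_def)
    from minty[OF this] show ?thesis by (simp add: v_def zero_le_mult_iff)
  qed
  then show "0 \<le> B p \<bullet> (y - p)" using LIMSEQ_le_const[OF lim] by blast
qed fact

theorem theorem8p5:
  fixes C :: "'a::{real_inner, complete_space} set"
    and B :: "'a \<Rightarrow> 'a"
    and L \<kappa> :: real
    and \<beta> \<theta> \<omega> lam :: "nat \<Rightarrow> real"
    and x u :: "nat \<Rightarrow> 'a"
  assumes "C \<noteq> {}" and "closed C" and "convex C"
    and "monotone_operator B"
    and "L > 0" and "L-lipschitz_on UNIV B"
    and "VI_solutions C B \<noteq> {}"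
    and "\<And>k. 0 \<le> \<beta> k" and "\<And>k. \<beta> k \<le> 1/4" and "summable \<beta>"
    and "\<And>k. \<theta> k = 1 - \<beta> k"
    and "0 < \<kappa>" and "\<kappa> \<le> 1/6"
    and "\<And>k. 0 \<le> \<omega> k" and "summable \<omega>"
    and "lam 0 > 0"
    and "\<And>k. lam (Suc k) =
           ratio_step (lam 0) \<kappa> (\<omega> k) (lam k) (secant_slope B (u k) (u (Suc k)))"
    and "x 0 \<in> C" and "u 0 = x 0"
    and "\<And>k. x (Suc k) = metric_proj C (x k - lam k *\<^sub>R B (u k))"
    and "\<And>k. u (Suc k) = x (Suc k) + \<theta> (Suc k) *\<^sub>R (x (Suc k) - x k)
                          + \<beta> (Suc k) *\<^sub>R (x (Suc k) - u k)"
  shows "(\<exists>p \<in> VI_solutions C B. weakly_converges_to x p)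
    \<and> (\<lambda>k. norm (x (Suc k) - x k)) \<longlonglongrightarrow> 0
    \<and> (\<lambda>k. norm (u k - x k)) \<longlonglongrightarrow> 0"
proof -
  note C = assms(1-3) and mono = assms(4) and lip = assms(6)
  have xC: "x k \<in> C" for k
  proof (cases k)
    case (Suc j)
    then show ?thesis using metric_proj_in[OF C] assms(20) by simp
  qed (use assms(18) in simp)
  have proj: "0 \<le> (x (Suc k) - x k + lam k *\<^sub>R B (u k)) \<bullet> (y - x (Suc k))" if "y \<in> C" for k y
    using metric_proj_dot[OF C that, of "x k - lam k *\<^sub>R B (u k)"]
    by (simp add: assms(20)[symmetric] algebra_simps)
  have reflect: "u (Suc k) - x (Suc k) = (x (Suc k) - x k) - \<beta> (Suc k) *\<^sub>R (u k - x k)" for k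
    by (simp add: assms(11,21) algebra_simps)

  \<comment> \<open>Behaviour of the step sizes\<close>
  define m where "m = min (lam 0) (\<kappa> / L)"
  have "0 < m" using assms(5,12,16) by (simp add: m_def)
  have slope: "0 \<le> secant_slope B v w" "secant_slope B v w \<le> L" for v w
    using lipschitz_onD[OF lip, of w v] assms(5)
    by (auto simp: secant_slope_def dist_norm divide_le_eq)
  have lam_le: "lam (Suc k) \<le> lam 0" "lam (Suc k) \<le> lam k * (1 + \<omega> k)" for k
    by (auto simp: assms(17) ratio_step_def)
  then have lam_le0: "lam k \<le> lam 0" for k by (cases k) auto
  \<comment> \<open>Secant slopes never exceed \<open>L\<close> and growth factors are at least 1,
    so no branch of the minimum falls below \<open>m\<close>.\<close>
  have lam_ge: "m \<le> lam k" for k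
  proof (induction k)
    case (Suc k)
    then have "0 < lam k" using \<open>0 < m\<close> by linarith
    then have "lam k * 1 \<le> lam k * (1 + \<omega> k)" using assms(14)[of k] by (intro mult_left_mono) auto
    then have "m \<le> lam k * (1 + \<omega> k)" using Suc by linarith
    moreover have "m \<le> \<kappa> / secant_slope B (u k) (u (Suc k))" if "secant_slope B (u k) (u (Suc k)) \<noteq> 0"
    proof -
      have "\<kappa> / L \<le> \<kappa> / secant_slope B (u k) (u (Suc k))"
        using that slope[of "u k" "u (Suc k)"] assms(5,12) by (intro divide_left_mono) auto
      then show ?thesis by (simp add: m_def)
    qed
    ultimately show ?case by (simp add: assms(17)[of k] ratio_step_def) (simp add: m_def)
  qed (simp add: m_def)
  have lam_pos: "0 < lam k" for k using lam_ge[of k] \<open>0 < m\<close> by linarith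
  \<comment> \<open>The rule in product form; if the slope vanishes, the two values of
    \<open>B\<close> agree and the left side is 0.\<close>
  have secant: "lam (Suc k) * norm (B (u (Suc k)) - B (u k)) \<le> \<kappa> * norm (u (Suc k) - u k)" for k
  proof (cases "secant_slope B (u k) (u (Suc k)) = 0")
    case True
    then show ?thesis using assms(12) by (auto simp: secant_slope_def split: if_splits)
  next
    case False
    then have "0 < secant_slope B (u k) (u (Suc k))" using slope(1)[of "u k" "u (Suc k)"] by simp
    moreover have "lam (Suc k) \<le> \<kappa> / secant_slope B (u k) (u (Suc k))"
      using False by (simp add: assms(17)[of k] ratio_step_def)
    ultimately have "lam (Suc k) * secant_slope B (u k) (u (Suc k)) \<le> \<kappa>" by (simp add: pos_le_divide_eq)
    moreover have "u (Suc k) \<noteq> u k" using False by (auto simp: secant_slope_def)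
    ultimately show ?thesis by (simp add: secant_slope_def divide_le_eq)
  qed
  \<comment> \<open>As \<open>lam k \<le> lam 0\<close>, growth adds at most the summable amount
    \<open>lam 0 * \<omega> k\<close>.\<close>
  have "convergent lam"
  proof (rule convergent_of_almost_decreasing(1)[of 0 lam "\<lambda>_. 0" "\<lambda>k. lam 0 * \<omega> k" 0])
    fix k show "lam (Suc k) + 0 \<le> lam k + lam 0 * \<omega> k"
      using lam_le(2)[of k] mult_right_mono[OF lam_le0[of k] assms(14)[of k]] by (simp add: algebra_simps)
    show "0 \<le> lam k" using lam_pos[of k] by simp
  qed (auto intro: summable_mult assms(15))
  then obtain l where l: "lam \<longlonglongrightarrow> l" by (auto simp: convergent_def)
  have "m \<le> l" using LIMSEQ_le_const[OF l] lam_ge by blast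

  \<comment> \<open>Since every step is at least \<open>m\<close>, differences below
    \<open>m / 10\<close> put the ratios of consecutive steps between 9/10 and 11/10.\<close>
  have "(\<lambda>k. lam (Suc k) - lam k) \<longlonglongrightarrow> l - l" using l by (intro tendsto_intros LIMSEQ_Suc)
  then have "(\<lambda>k. lam (Suc k) - lam k) \<longlonglongrightarrow> 0" by simp
  from tendstoD[OF this, of "m / 10"] obtain N1 where N1: "\<And>k. k \<ge> N1 \<Longrightarrow> \<bar>lam (Suc k) - lam k\<bar> < m / 10"
    using \<open>0 < m\<close> by (auto simp: eventually_sequentially dist_real_def)
  from tendstoD[OF summable_LIMSEQ_zero[OF assms(10)], of "1/100"]
  obtain N2 where N2: "\<And>k. k \<ge> N2 \<Longrightarrow> \<beta> k < 1/100"
    using assms(8) by (auto simp: eventually_sequentially)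
  define b where "b k = (22 + 10 * lam 0 * L) * \<beta> (Suc k)" for k
  have b: "0 \<le> b k" for k using assms(5,8,16) by (simp add: b_def)
  have "summable b" unfolding b_def using assms(10) by (intro summable_mult) (simp add: summable_Suc_iff)

  \<comment> \<open>Convergence of the energy and vanishing increments\<close>
  have limits: "convergent (\<lambda>k. norm (x k - z)) \<and> (\<lambda>k. u k - x k) \<longlonglongrightarrow> 0
      \<and> (\<lambda>k. x (Suc k) - u k) \<longlonglongrightarrow> 0" if "z \<in> VI_solutions C B" for z
  proof -
    define A where "A k = B z \<bullet> (x k - z)" for k
    have A: "0 \<le> A k" for k using that xC by (simp add: A_def VI_solutions_def)
    have "z \<in> C" using that by (simp add: VI_solutions_def)
    define V where "V k = (norm (x (Suc k) - z))\<^sup>2 + (norm (x (Suc k) - u k))\<^sup>2 / 3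
      + (norm (u k - x k))\<^sup>2 / 10 + 2 * lam (Suc k) * A k" for k
    \<comment> \<open>The fixed coefficient \<open>m\<close>, a lower bound for all steps, lets
      summability of \<open>D\<close> force \<open>A\<close> to 0.\<close>
    define D where "D k = (norm (u (Suc k) - x (Suc k)))\<^sup>2 / 10
      + (norm (x (Suc (Suc k)) - u (Suc k)))\<^sup>2 / 10 + m * A (Suc k)" for k
    have D0: "0 \<le> D k" for k using A \<open>0 < m\<close> by (simp add: D_def)
    have V0: "0 \<le> V k" for k using A lam_pos[of "Suc k"] by (simp add: V_def)
    have step: "V (Suc k) + D k \<le> (1 + b k) * V k" if "k \<ge> max N1 N2" for k
      unfolding V_def D_def b_def A_def
    proof (rule projected_reflected_gradient_descent[OF mono lip reflect proj[OF \<open>z \<in> C\<close>] proj[OF xC] proj[OF xC] secant])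
      show "9/10 * lam k \<le> lam (Suc k)" "lam (Suc k) \<le> 11/10 * lam k"
        using N1[of k] that lam_ge[of k] by linarith+
      show "lam (Suc (Suc k)) \<le> 11/10 * lam (Suc k)"
        using N1[of "Suc k"] that lam_ge[of "Suc k"] by linarith
      show "\<beta> (Suc k) \<le> 1/100" using N2[of "Suc k"] that by auto
      show "0 \<le> B z \<bullet> (x k - z)" "0 \<le> B z \<bullet> (x (Suc k) - z)" using A by (auto simp: A_def)
    qed (use assms(8,12,13) lam_pos lam_le0 lam_ge \<open>0 < m\<close> in \<open>auto intro: less_imp_le\<close>)
    have "convergent V" and "summable D"
      using robbins_siegmund[of "max N1 N2" V D b] step D0 V0 b \<open>summable b\<close> by blast+
    have Dlim: "D \<longlonglongrightarrow> 0" using \<open>summable D\<close> by (rule summable_LIMSEQ_zero)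
    have "(\<lambda>k. 10 * D k) \<longlonglongrightarrow> 10 * 0" "(\<lambda>k. inverse m * D k) \<longlonglongrightarrow> inverse m * 0"
      by (intro tendsto_intros Dlim)+
    then have Dlim': "(\<lambda>k. 10 * D k) \<longlonglongrightarrow> 0" "(\<lambda>k. inverse m * D k) \<longlonglongrightarrow> 0" by simp_all
    have mA: "0 \<le> m * A k" for k using A \<open>0 < m\<close> by simp
    have "(\<lambda>k. (norm (u (Suc k) - x (Suc k)))\<^sup>2) \<longlonglongrightarrow> 0"
      by (rule tendsto_sandwich[OF _ _ tendsto_const Dlim'(1)]) (use mA in \<open>auto simp: D_def\<close>)
    then have d: "(\<lambda>k. (norm (u k - x k))\<^sup>2) \<longlonglongrightarrow> 0" by (rule LIMSEQ_imp_Suc)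
    have "(\<lambda>k. (norm (x (Suc (Suc k)) - u (Suc k)))\<^sup>2) \<longlonglongrightarrow> 0"
      by (rule tendsto_sandwich[OF _ _ tendsto_const Dlim'(1)]) (use mA in \<open>auto simp: D_def\<close>)
    then have e: "(\<lambda>k. (norm (x (Suc k) - u k))\<^sup>2) \<longlonglongrightarrow> 0" by (rule LIMSEQ_imp_Suc)
    have "(\<lambda>k. A (Suc k)) \<longlonglongrightarrow> 0"
      by (rule tendsto_sandwich[OF _ _ tendsto_const Dlim'(2)])
         (use A \<open>0 < m\<close> in \<open>auto simp: D_def field_simps\<close>)
    then have Alim: "A \<longlonglongrightarrow> 0" by (rule LIMSEQ_imp_Suc)
    obtain v where v: "V \<longlonglongrightarrow> v" using \<open>convergent V\<close> by (auto simp: convergent_def)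
    \<comment> \<open>All terms of \<open>V\<close> except the squared distance to \<open>z\<close>
      vanish in the limit; the one with \<open>A k\<close> does so because the steps
      converge.\<close>
    have "(\<lambda>k. V k - (norm (x (Suc k) - u k))\<^sup>2 / 3 - (norm (u k - x k))\<^sup>2 / 10 - 2 * lam (Suc k) * A k)
      \<longlonglongrightarrow> v - 0 / 3 - 0 / 10 - 2 * l * 0"
      by (intro tendsto_intros v d e Alim LIMSEQ_Suc[OF l]) auto
    then have "(\<lambda>k. (norm (x (Suc k) - z))\<^sup>2) \<longlonglongrightarrow> v" by (simp add: V_def)
    then have "(\<lambda>k. sqrt ((norm (x (Suc k) - z))\<^sup>2)) \<longlonglongrightarrow> sqrt v" by (rule tendsto_real_sqrt)
    then have "(\<lambda>k. norm (x (Suc k) - z)) \<longlonglongrightarrow> sqrt v" by simp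
    then have "(\<lambda>k. norm (x k - z)) \<longlonglongrightarrow> sqrt v" by (rule LIMSEQ_imp_Suc)
    then have "convergent (\<lambda>k. norm (x k - z))" by (auto simp: convergent_def)
    moreover have "(\<lambda>k. u k - x k) \<longlonglongrightarrow> 0"
      using tendsto_real_sqrt[OF d] by (simp add: tendsto_norm_zero_iff)
    moreover have "(\<lambda>k. x (Suc k) - u k) \<longlonglongrightarrow> 0"
      using tendsto_real_sqrt[OF e] by (simp add: tendsto_norm_zero_iff)
    ultimately show ?thesis by blast
  qed
  obtain z where z: "z \<in> VI_solutions C B" using assms(7) by blast
  have w: "(\<lambda>k. u k - x k) \<longlonglongrightarrow> 0" and r: "(\<lambda>k. x (Suc k) - u k) \<longlonglongrightarrow> 0"
    and "convergent (\<lambda>k. norm (x k - z))" using limits[OF z] by auto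
  have \<delta>: "(\<lambda>k. x (Suc k) - x k) \<longlonglongrightarrow> 0"
    using tendsto_add[OF r w] by simp
  have "Bseq (\<lambda>k. norm (x k - z))" by (rule convergent_imp_Bseq) fact
  then obtain K1 where K1: "\<And>k. norm (x k - z) \<le> K1" unfolding Bseq_def by auto
  have "Bseq (\<lambda>k. u k - x k)" using w by (intro convergent_imp_Bseq) (auto simp: convergent_def)
  then obtain K2 where K2: "\<And>k. norm (u k - x k) \<le> K2" unfolding Bseq_def by auto
  define K where "K = norm (B z) + L * (K1 + K2)"
  have K: "norm (B (u k)) \<le> K" for k
  proof -
    have "norm (u k - z) \<le> K1 + K2"
      using norm_triangle_ineq[of "u k - x k" "x k - z"] K1[of k] K2[of k] by simp
    then have "L * norm (u k - z) \<le> L * (K1 + K2)" using assms(5) by simp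
    moreover have "norm (B (u k) - B z) \<le> L * norm (u k - z)"
      using lipschitz_onD[OF lip, of "u k" z] by (simp add: dist_norm)
    ultimately show ?thesis using norm_triangle_ineq[of "B (u k) - B z" "B z"] by (simp add: K_def)
  qed

  \<comment> \<open>Weak cluster points solve the variational inequality\<close>
  have cluster: "p \<in> VI_solutions C B"
    if G: "G \<le> sequentially" "G \<noteq> bot" "\<And>y. ((\<lambda>k. x k \<bullet> y) \<longlongrightarrow> p \<bullet> y) G" for G p
  proof (rule minty[OF C(3)])
    show "continuous_on UNIV B" using lip by (rule lipschitz_on_continuous_on)
    show "p \<in> C" by (rule weak_limit_in_closed_convex[OF C(2,3) xC G(2,3)])
    fix y assume "y \<in> C"
    \<comment> \<open>\<open>E\<close> bounds the increment term of the projection inequality tested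
      with \<open>y\<close>, together with the cost of replacing \<open>x (Suc k)\<close> by
      \<open>u k\<close>.\<close>
    define E where "E k = norm (x (Suc k) - x k) * (norm (y - z) + K1) + lam k * (K * norm (x (Suc k) - u k))" for k
    have "E \<longlonglongrightarrow> norm (0::'a) * (norm (y - z) + K1) + l * (K * norm (0::'a))"
      unfolding E_def by (intro tendsto_intros \<delta> r l)
    then have E: "E \<longlonglongrightarrow> 0" by simp
    have "(\<lambda>k. B y \<bullet> (u k - x k)) \<longlonglongrightarrow> B y \<bullet> 0" by (intro tendsto_intros w)
    then have wy: "(\<lambda>k. B y \<bullet> (u k - x k)) \<longlonglongrightarrow> 0" by simp
    have lim: "((\<lambda>k. lam k * (B y \<bullet> y - x k \<bullet> B y - B y \<bullet> (u k - x k)) + E k)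
      \<longlongrightarrow> l * (B y \<bullet> y - p \<bullet> B y - 0) + 0) G"
      by (intro tendsto_intros G tendsto_mono[OF G(1)] l wy E)
    have "0 \<le> lam k * (B y \<bullet> y - x k \<bullet> B y - B y \<bullet> (u k - x k)) + E k" for k
    proof -
      \<comment> \<open>Monotonicity trades \<open>B (u k)\<close> for the fixed vector
        \<open>B y\<close>, after which only linear functionals of the iterates remain and weak
        limits apply.\<close>
      have "B (u k) \<bullet> (y - u k) \<le> B y \<bullet> (y - u k)"
        using mono unfolding monotone_operator_def by (metis diff_ge_0_iff_ge inner_diff_left)
      then have "lam k * (B (u k) \<bullet> (y - u k)) \<le> lam k * (B y \<bullet> (y - u k))"
        using lam_pos[of k] by simp
      moreover have "lam k * (B (u k) \<bullet> (u k - x (Suc k))) \<le> lam k * (K * norm (x (Suc k) - u k))"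
      proof (rule mult_left_mono)
        show "B (u k) \<bullet> (u k - x (Suc k)) \<le> K * norm (x (Suc k) - u k)"
          using norm_cauchy_schwarz[of "B (u k)" "u k - x (Suc k)"]
            mult_right_mono[OF K[of k] norm_ge_zero[of "u k - x (Suc k)"]]
          by (simp add: norm_minus_commute)
      qed (use lam_pos[of k] in simp)
      moreover have "(x (Suc k) - x k) \<bullet> (y - x (Suc k)) \<le> norm (x (Suc k) - x k) * (norm (y - z) + K1)"
      proof -
        have "norm (y - x (Suc k)) \<le> norm (y - z) + K1"
          using norm_triangle_ineq4[of "y - z" "x (Suc k) - z"] K1[of "Suc k"] by simp
        then show ?thesis
          using norm_cauchy_schwarz order_trans mult_left_mono norm_ge_zero by metis
      qed
      moreover have "0 \<le> (x (Suc k) - x k) \<bullet> (y - x (Suc k)) + lam k * (B (u k) \<bullet> (y - u k))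
          + lam k * (B (u k) \<bullet> (u k - x (Suc k)))"
        using proj[OF \<open>y \<in> C\<close>, of k] by (simp add: inner_simps algebra_simps)
      moreover have "B y \<bullet> y - x k \<bullet> B y - B y \<bullet> (u k - x k) = B y \<bullet> (y - u k)"
        by (simp add: inner_diff_right inner_commute)
      ultimately show ?thesis by (simp add: E_def)
    qed
    \<comment> \<open>The limit \<open>l\<close> is at least \<open>m > 0\<close>, so it can be
      cancelled.\<close>
    then have "0 \<le> l * (B y \<bullet> (y - p))"
      using tendsto_lowerbound[OF lim _ G(2), of 0] by (simp add: inner_diff_right inner_commute)
    then show "0 \<le> B y \<bullet> (y - p)"
      using \<open>m \<le> l\<close> \<open>0 < m\<close> by (simp add: zero_le_mult_iff)
  qed
  have "\<exists>p\<in>VI_solutions C B. weakly_converges_to x p"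
    using assms(7) limits cluster by (intro Opial) auto
  then show ?thesis using tendsto_norm_zero[OF \<delta>] tendsto_norm_zero[OF w] by simp
qed

end
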